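(* Let $t$ be a fixed time instant, $m>0$, and $\{\mathcal{F}_u\}_{u=1}^t$ a filtration. Let $\{a_u\}_{u=1}^t$ be a stochastic process in $\mathbb{R}^d$ with $a_u$ $\mathcal{F}_u$-measurable and $\|a_u\|_2\le1$. Let $\{\epsilon_u\}_{u=2}^t$ be a martingale difference sequence with $\epsilon_{u+1}$ $\mathcal{F}_{u+1}$-measurable, $\mathbb{E}[\epsilon_{u+1}\mid\mathcal{F}_u]=0$, and $|\epsilon_{u+1}|\le m$ almost surely. Let $\{w_u\}$ be deterministic, strictly positive, non-decreasing weights and $\{\lambda_u\}$ a deterministic sequence of positive regularization parameters. Let $\sigma_u^2=\mathbb{E}[\epsilon_{u+1}^2\mid\mathcal{F}_u]$, $\widetilde H_t=\sum_{s=1}^{t-1}w_s^2\sigma_s^2a_sa_s^\top+\lambda_{t-1}I_d$ and $S_t=\sum_{s=1}^{t-1}w_s\epsilon_{s+1}a_s$. Then for any $\delta\in(0,1]$, $$\|S_t\|_{\widetilde H_t^{-1}}\ \ge\ \frac{\sqrt{\lambda_{t-1}}}{2mw_{t-1}}+\frac{2mw_{t-1}}{\sqrt{\lambda_{t-1}}}\log\Big(\frac{\det(\widetilde H_t)^{1/2}}{\delta\,\lambda_{t-1}^{d/2}}\Big)+\frac{2mw_{t-1}}{\sqrt{\lambda_{t-1}}}d\log(2)$$ holds with probability at most $\delta$.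
   Context: $\|x\|_M=\sqrt{x^\top Mx}$ for a positive definite matrix $M$; $I_d$ is the $d\times d$ identity. *)

theory Defs
  imports "HOL-Probability.Probability"
begin

definition mat_norm :: "real^'d^'d \<Rightarrow> real^'d \<Rightarrow> real" where
  "mat_norm A x = sqrt (x \<bullet> (A *v x))"

definition outer :: "real^'d \<Rightarrow> real^'d \<Rightarrow> real^'d^'d" where
  "outer a b = (\<chi> i j. a $ i * b $ j)"

end

theory Submission
  imports Defs
begin

text \<open>
  Method of mixtures. For a fixed direction \<open>\<xi>\<close> with \<open>m w\<^sub>n \<parallel>\<xi>\<parallel> \<le> 1\<close>, where \<open>n = t - 1\<close>, the inequality
  \<open>e\<^sup>x \<le> 1 + x + x\<^sup>2\<close> on \<open>[-1, 1]\<close> makes \<open>exp (\<xi> \<bullet> S - \<xi> \<bullet> G \<xi>)\<close> a supermartingale, where \<open>G = H - \<lambda> I\<close>.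
  Average it over \<open>\<xi>\<close> with the Gaussian weight \<open>exp (-\<lambda> \<parallel>\<xi>\<parallel>\<^sup>2)\<close> truncated to the ball of radius
  \<open>2r = 1 / (m w\<^sub>n)\<close> and apply Markov's inequality. To bound the average from below, recentre at
  \<open>z = \<beta> H\<^sup>-\<^sup>1 S / \<parallel>S\<parallel>\<close> with \<open>\<beta> = r \<surd>\<lambda>\<close> and the norm taken in \<open>H\<^sup>-\<^sup>1\<close>, which lies in the ball of radius \<open>r\<close>: the
  linear term cancels by symmetry and Jensen, leaving \<open>exp (\<beta> \<parallel>S\<parallel> - \<beta>\<^sup>2)\<close> times a Gaussian integral over
  the ball of radius \<open>r\<close>, which a linear substitution compares with the normalizing constant. This yields
  the factors \<open>det H\<close> and \<open>2\<^sup>d\<close>.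
\<close>

subsection \<open>Lebesgue measure under linear maps\<close>

lemma nn_integral_lborel_translate:
  fixes f :: "'a::euclidean_space \<Rightarrow> ennreal"
  assumes [measurable]: "f \<in> borel_measurable borel"
  shows "(\<integral>\<^sup>+x. f (c + x) \<partial>lborel) = (\<integral>\<^sup>+x. f x \<partial>lborel)"
proof -
  have "(\<integral>\<^sup>+x. f x \<partial>lborel) = (\<integral>\<^sup>+x. f x \<partial>distr lborel borel ((+) c))"
    by (simp only: lborel_distr_plus)
  also have "\<dots> = (\<integral>\<^sup>+x. f (c + x) \<partial>lborel)"
    by (rule nn_integral_distr) auto
  finally show ?thesis ..
qed

lemma nn_integral_lborel_reflect:
  fixes f :: "'a::euclidean_space \<Rightarrow> ennreal"
  assumes [measurable]: "f \<in> borel_measurable borel"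
  shows "(\<integral>\<^sup>+x. f (- x) \<partial>lborel) = (\<integral>\<^sup>+x. f x \<partial>lborel)"
proof -
  have "lborel = distr (lborel :: 'a measure) borel uminus"
    using lborel_affine[of "-1" "0 :: 'a"] by (simp add: density_1)
  then have "(\<integral>\<^sup>+x. f x \<partial>lborel) = (\<integral>\<^sup>+x. f x \<partial>distr lborel borel uminus)"
    by simp
  also have "\<dots> = (\<integral>\<^sup>+x. f (- x) \<partial>lborel)"
    by (rule nn_integral_distr) auto
  finally show ?thesis ..
qed

text \<open>Fubini with the \<open>e\<close>-coordinate innermost: since \<open>v\<close> is
  orthogonal to \<open>e\<close>, the shift \<open>v \<bullet> x\<close> depends on the other
  coordinates alone. For fixed values of those the shear is a translation of the real line, which
  preserves the inner integral.\<close>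

lemma nn_integral_lborel_shear:
  fixes f :: "'a::euclidean_space \<Rightarrow> ennreal"
  assumes [measurable]: "f \<in> borel_measurable borel"
    and "e \<in> Basis" and orth: "v \<bullet> e = 0"
  shows "(\<integral>\<^sup>+x. f (x + (v \<bullet> x) *\<^sub>R e) \<partial>lborel) = (\<integral>\<^sup>+x. f x \<partial>lborel)"
proof -
  interpret product_sigma_finite "\<lambda>b::'a. lborel :: real measure" ..
  define B where "B = Basis - {e}"
  have B: "finite B" "e \<notin> B" "Basis = insert e B"
    using \<open>e \<in> Basis\<close> by (auto simp: B_def)
  let ?s = "\<lambda>y. \<Sum>b\<in>Basis. y b *\<^sub>R b :: 'a"
  have split: "(\<integral>\<^sup>+x. g x \<partial>lborel) =
      (\<integral>\<^sup>+y. (\<integral>\<^sup>+r. g (r *\<^sub>R e + (\<Sum>b\<in>B. y b *\<^sub>R b)) \<partial>lborel) \<partial>(\<Pi>\<^sub>M b\<in>B. lborel))"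
    if [measurable]: "g \<in> borel_measurable borel" for g :: "'a \<Rightarrow> ennreal"
  proof -
    have "(\<integral>\<^sup>+x. g x \<partial>lborel) = (\<integral>\<^sup>+x. g x \<partial>distr (\<Pi>\<^sub>M b\<in>Basis. lborel) borel ?s)"
      by (subst lborel_eq) simp
    also have "\<dots> = (\<integral>\<^sup>+y. g (?s y) \<partial>(\<Pi>\<^sub>M b\<in>insert e B. lborel))"
      by (subst nn_integral_distr) (auto simp: B(3)[symmetric])
    also have "\<dots> = (\<integral>\<^sup>+y. (\<integral>\<^sup>+r. g (?s (y(e := r))) \<partial>lborel) \<partial>(\<Pi>\<^sub>M b\<in>B. lborel))"
      by (rule product_nn_integral_insert) (auto simp: B(1,2) B(3)[symmetric])
    moreover have "?s (y(e := r)) = r *\<^sub>R e + (\<Sum>b\<in>B. y b *\<^sub>R b)" for y r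
    proof -
      have "(\<Sum>b\<in>B. (y(e := r)) b *\<^sub>R b) = (\<Sum>b\<in>B. y b *\<^sub>R b)"
        using B(2) by (intro sum.cong) auto
      then show ?thesis by (simp add: B)
    qed
    ultimately show ?thesis by simp
  qed
  have "(\<integral>\<^sup>+r. f (r *\<^sub>R e + z + (v \<bullet> (r *\<^sub>R e + z)) *\<^sub>R e) \<partial>lborel) =
      (\<integral>\<^sup>+r. f (r *\<^sub>R e + z) \<partial>lborel)" for z
  proof -
    have "r *\<^sub>R e + z + (v \<bullet> (r *\<^sub>R e + z)) *\<^sub>R e = (v \<bullet> z + r) *\<^sub>R e + z" for r
      using orth by (simp add: algebra_simps)
    then show ?thesis
      using nn_integral_lborel_translate[of "\<lambda>r. f (r *\<^sub>R e + z)" "v \<bullet> z"]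
      by (simp only:) measurable
  qed
  then show ?thesis
    by (subst (1 2) split) auto
qed

lemma Basis_real_vec: "(Basis :: (real^'n) set) = range (\<lambda>i. axis i 1)"
  by (auto simp: Basis_vec_def)

lemma inj_axis_1: "inj (\<lambda>i::'n::finite. axis i (1::real))"
  by (auto simp: inj_on_def axis_eq_axis)

text \<open>Lebesgue measure is determined by its values on boxes. The preimage of a box is the box
  whose sides are rearranged by \<open>inv p\<close>, and the product of the side lengths does not
  see the order.\<close>

lemma distr_lborel_permute_coords:
  fixes p :: "'n::finite \<Rightarrow> 'n"
  assumes "bij p"
  shows "distr lborel borel (\<lambda>x::real^'n. \<chi> i. x $ p i) = lborel"
proof (rule lborel_eqI[symmetric])
  have [measurable]: "(\<lambda>x::real^'n. \<chi> i. x $ p i) \<in> borel_measurable borel"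
    by (intro borel_measurable_continuous_onI continuous_on_vec_lambda continuous_intros)
  have prodB: "(\<Prod>b\<in>Basis. w \<bullet> b) = (\<Prod>i\<in>UNIV. w $ i)" for w :: "real^'n"
    by (simp add: Basis_real_vec prod.reindex[OF inj_axis_1] inner_axis)
  fix l u :: "real^'n"
  assume "\<And>b. b \<in> Basis \<Longrightarrow> l \<bullet> b \<le> u \<bullet> b"
  then have le: "l $ i \<le> u $ i" for i
    by (metis axis_in_Basis_iff cart_eq_inner_axis insertI1 Basis_real_def)
  define q where "q = inv p"
  have pq: "p (q i) = i" "q (p i) = i" for i
    using assms by (auto simp: q_def bij_is_inj bij_is_surj surj_f_inv_f)
  have "(\<lambda>x::real^'n. \<chi> i. x $ p i) -` box l u = box (\<chi> i. l $ q i) (\<chi> i. u $ q i)"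
    by (auto simp: mem_box_cart) (metis pq)+
  then have "emeasure (distr lborel borel (\<lambda>x. \<chi> i. x $ p i)) (box l u) =
      emeasure lborel (box (\<chi> i. l $ q i) (\<chi> i. u $ q i))"
    by (subst emeasure_distr) auto
  also have "\<dots> = ennreal (\<Prod>i\<in>UNIV. u $ q i - l $ q i)"
    using le by (subst emeasure_lborel_box) (auto simp: prodB, auto simp: Basis_real_vec inner_axis)
  also have "(\<Prod>i\<in>UNIV. u $ q i - l $ q i) = (\<Prod>i\<in>UNIV. u $ i - l $ i)"
    by (rule prod.reindex_bij_betw[of q UNIV UNIV "\<lambda>i. u $ i - l $ i"]) (simp add: q_def assms bij_imp_bij_inv)
  finally show "emeasure (distr lborel borel (\<lambda>x. \<chi> i. x $ p i)) (box l u) = (\<Prod>b\<in>Basis. (u - l) \<bullet> b)"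
    by (simp add: prodB)
qed simp

text \<open>
  The change of variables theorem of HOL-Analysis requires a well-ordered index type. Stating only
  \<open>\<le>\<close> covers singular maps as well and suffices below.
\<close>

lemma det_nn_integral_linear_le:
  fixes g :: "real^'n \<Rightarrow> real^'n" and f :: "real^'n \<Rightarrow> ennreal"
  assumes "linear g" and "f \<in> borel_measurable borel"
  shows "ennreal \<bar>det (matrix g)\<bar> * (\<integral>\<^sup>+x. f (g x) \<partial>lborel) \<le> (\<integral>\<^sup>+x. f x \<partial>lborel)"
proof -
  \<comment> \<open>The quantifier over \<open>f\<close> belongs inside the induction: for a
    composition \<open>g \<circ> h\<close>, the hypothesis for \<open>h\<close> is applied to the
    integrand \<open>\<lambda>x. f (g x)\<close>.\<close>
  have "\<forall>f::real^'n \<Rightarrow> ennreal. f \<in> borel_measurable borel \<longrightarrow>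
      ennreal \<bar>det (matrix g)\<bar> * (\<integral>\<^sup>+x. f (g x) \<partial>lborel) \<le> (\<integral>\<^sup>+x. f x \<partial>lborel)"
    (is "?P g")
    using \<open>linear g\<close>
  proof (rule induct_linear_elementary)
    fix g h :: "real^'n \<Rightarrow> real^'n"
    assume lin: "linear g" "linear h" and g: "?P g" and h: "?P h"
    have [measurable]: "g \<in> borel_measurable borel"
      using lin by (intro borel_measurable_continuous_onI linear_continuous_on)
        (simp add: linear_conv_bounded_linear)
    have det: "ennreal \<bar>det (matrix (g \<circ> h))\<bar> = ennreal \<bar>det (matrix g)\<bar> * ennreal \<bar>det (matrix h)\<bar>"
      using lin by (simp add: matrix_compose det_mul abs_mult ennreal_mult)
    show "?P (g \<circ> h)"
    proof (intro allI impI)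
      fix f :: "real^'n \<Rightarrow> ennreal" assume [measurable]: "f \<in> borel_measurable borel"
      have "ennreal \<bar>det (matrix g)\<bar> * (ennreal \<bar>det (matrix h)\<bar> * (\<integral>\<^sup>+x. f (g (h x)) \<partial>lborel))
          \<le> ennreal \<bar>det (matrix g)\<bar> * (\<integral>\<^sup>+x. f (g x) \<partial>lborel)"
        using h[rule_format, of "\<lambda>x. f (g x)"] by (intro mult_left_mono) auto
      also have "\<dots> \<le> (\<integral>\<^sup>+x. f x \<partial>lborel)"
        using g by simp
      finally show "ennreal \<bar>det (matrix (g \<circ> h))\<bar> * (\<integral>\<^sup>+x. f ((g \<circ> h) x) \<partial>lborel) \<le> (\<integral>\<^sup>+x. f x \<partial>lborel)"
        by (simp add: det mult.assoc)
    qed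
  next
    fix g :: "real^'n \<Rightarrow> real^'n" and i
    assume "linear g" and "\<And>x. g x $ i = 0"
    \<comment> \<open>A singular map gives determinant 0, and the left-hand side is 0 even if the
      integral is infinite, because \<open>0 * \<infinity> = 0\<close> in
      \<open>ennreal\<close>.\<close>
    then have "row i (matrix g) = 0"
      by (simp add: row_def matrix_def vec_eq_iff)
    then show "?P g" by (simp add: det_zero_row)
  next
    fix c :: "'n \<Rightarrow> real"
    let ?g = "\<lambda>x::real^'n. \<chi> i. c i * x $ i"
    have det: "det (matrix ?g) = (\<Prod>i\<in>UNIV. c i)"
      by (subst det_diagonal) (auto simp: matrix_def axis_def)
    show "?P ?g"
    proof (cases "\<exists>i. c i = 0")
      case True
      then have "det (matrix ?g) = 0" by (auto simp: det)
      then show ?thesis by simp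
    next
      case False
      \<comment> \<open>The affine transformation rule for \<open>lborel\<close> takes its
        coefficients indexed by basis vectors, so \<open>d\<close> moves \<open>c\<close> from
        indices to \<open>Basis\<close>; the description is unique because \<open>axis i 1\<close>
        determines \<open>i\<close>.\<close>
      define d where "d b = c (THE i. b = axis i 1)" for b :: "real^'n"
      have d: "d (axis i 1) = c i" for i by (simp add: d_def axis_eq_axis)
      have g: "?g = (\<lambda>x. 0 + (\<Sum>j\<in>Basis. (d j * (x \<bullet> j)) *\<^sub>R j))"
        by (simp add: Basis_real_vec sum.reindex[OF inj_axis_1] d inner_axis fun_eq_iff vec_eq_iff)
          (simp add: axis_def if_distrib cong: if_cong)
      have "lborel = density (distr lborel borel ?g) (\<lambda>_. \<Prod>j\<in>Basis. \<bar>d j\<bar>)"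
        unfolding g using False d by (intro lborel_affine_euclidean) (auto simp: Basis_real_vec)
      also have "(\<Prod>j\<in>Basis. \<bar>d j\<bar>) = \<bar>det (matrix ?g)\<bar>"
        by (simp add: Basis_real_vec prod.reindex[OF inj_axis_1] d det abs_prod)
      finally have lb: "lborel = density (distr lborel borel ?g) (\<lambda>_. ennreal \<bar>det (matrix ?g)\<bar>)" .
      have [measurable]: "?g \<in> borel_measurable borel"
        by (intro borel_measurable_continuous_onI continuous_on_vec_lambda continuous_intros)
      have "(\<integral>\<^sup>+x. f x \<partial>lborel) = ennreal \<bar>det (matrix ?g)\<bar> * (\<integral>\<^sup>+x. f (?g x) \<partial>lborel)"
        if [measurable]: "f \<in> borel_measurable borel" for f :: "real^'n \<Rightarrow> ennreal"
        by (subst lb) (simp add: nn_integral_density nn_integral_distr nn_integral_cmult)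
      then show ?thesis by simp
    qed
  next
    fix m n :: 'n assume "m \<noteq> n"
    let ?p = "Transposition.transpose m n"
    let ?g = "\<lambda>x::real^'n. \<chi> i. x $ ?p i"
    have p: "?p permutes UNIV" by (simp add: permutes_swap_id)
    have "matrix ?g = (\<chi> i. (mat 1 :: real^'n^'n) $ ?p i)"
      by (simp add: matrix_def mat_def axis_def vec_eq_iff)
    then have det: "\<bar>det (matrix ?g)\<bar> = 1"
      by (simp add: det_permute_rows[OF p] sign_def)
    have [measurable]: "?g \<in> borel_measurable borel"
      by (intro borel_measurable_continuous_onI continuous_on_vec_lambda continuous_intros)
    have distr: "distr lborel borel ?g = lborel"
      by (rule distr_lborel_permute_coords) (simp add: permutes_bij[OF p])
    have eq: "(\<integral>\<^sup>+x. f (?g x) \<partial>lborel) = (\<integral>\<^sup>+x. f x \<partial>lborel)"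
      if [measurable]: "f \<in> borel_measurable borel" for f :: "real^'n \<Rightarrow> ennreal"
      using nn_integral_distr[of ?g lborel borel f] by (simp only: distr) measurable
    show "?P ?g"
    proof (intro allI impI)
      fix f :: "real^'n \<Rightarrow> ennreal" assume "f \<in> borel_measurable borel"
      from eq[OF this]
      show "ennreal \<bar>det (matrix ?g)\<bar> * (\<integral>\<^sup>+x. f (?g x) \<partial>lborel) \<le> (\<integral>\<^sup>+x. f x \<partial>lborel)"
        by (simp only: det ennreal_1 mult_1 order_refl)
    qed
  next
    fix m n :: 'n assume "m \<noteq> n"
    let ?g = "\<lambda>x::real^'n. \<chi> i. if i = m then x $ m + x $ n else x $ i"
    have "matrix ?g = (\<chi> k. if k = m then row m (mat 1) + 1 *s row n (mat 1) else row k (mat 1))"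
      by (auto simp: matrix_def mat_def axis_def row_def vec_eq_iff)
    then have det: "det (matrix ?g) = 1"
      by (simp add: det_row_operation[OF \<open>m \<noteq> n\<close>])
    \<comment> \<open>Adding coordinate \<open>n\<close> to coordinate \<open>m\<close> is a shear
      along \<open>axis m 1\<close>; the orthogonality condition is
      \<open>m \<noteq> n\<close>.\<close>
    have "?g x = x + (axis n 1 \<bullet> x) *\<^sub>R axis m 1" for x
      by (auto simp: vec_eq_iff inner_axis', auto simp: axis_def)
    then have eq: "(\<integral>\<^sup>+x. f (?g x) \<partial>lborel) = (\<integral>\<^sup>+x. f x \<partial>lborel)"
      if "f \<in> borel_measurable borel" for f :: "real^'n \<Rightarrow> ennreal"
      using nn_integral_lborel_shear[OF that, of "axis m 1" "axis n 1"] \<open>m \<noteq> n\<close>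
      by (simp add: inner_axis_axis axis_in_Basis_iff)
    show "?P ?g"
    proof (intro allI impI)
      fix f :: "real^'n \<Rightarrow> ennreal" assume "f \<in> borel_measurable borel"
      from eq[OF this]
      show "ennreal \<bar>det (matrix ?g)\<bar> * (\<integral>\<^sup>+x. f (?g x) \<partial>lborel) \<le> (\<integral>\<^sup>+x. f x \<partial>lborel)"
        by (simp only: det abs_one ennreal_1 mult_1 order_refl)
    qed
  qed
  then show ?thesis using assms by simp
qed

subsection \<open>Factorization of regularized Gram matrices\<close>

lemma outer_mult_vec: "outer u v *v x = (v \<bullet> x) *\<^sub>R u"
  by (simp add: outer_def matrix_vector_mult_def inner_vec_def vec_eq_iff sum_distrib_left mult_ac)

lemma
  fixes A :: "real^'n^'n"
  assumes "invertible A"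
  shows matrix_inv_left: "matrix_inv A ** A = mat 1"
    and matrix_inv_right: "A ** matrix_inv A = mat 1"
proof -
  have "A ** matrix_inv A = mat 1 \<and> matrix_inv A ** A = mat 1"
    using assms unfolding invertible_def matrix_inv_def by (rule someI_ex)
  then show "matrix_inv A ** A = mat 1" "A ** matrix_inv A = mat 1" by simp_all
qed

lemma invertible_if_positive_definite:
  fixes A :: "real^'n^'n"
  assumes "\<And>x. x \<noteq> 0 \<Longrightarrow> 0 < x \<bullet> (A *v x)"
  shows "invertible A"
proof -
  have "x = 0" if "A *v x = 0" for x
    using assms[of x] that by force
  then show ?thesis
    by (metis invertible_left_inverse matrix_left_invertible_ker)
qed

text \<open>
  Writing \<open>v = P\<^sup>T u\<close>, the new factor is \<open>(I + \<alpha> u u\<^sup>T) P\<close>, with \<open>\<alpha>\<close> the positive root of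
  \<open>2 \<alpha> + \<alpha>\<^sup>2 \<parallel>u\<parallel>\<^sup>2 = 1\<close>, so that \<open>(I + \<alpha> u u\<^sup>T)\<^sup>2 = I + u u\<^sup>T\<close>.
\<close>

lemma gram_rank_one_update:
  fixes P :: "real^'n^'n"
  assumes P: "invertible P"
  shows "\<exists>Q :: real^'n^'n. invertible Q \<and> transpose Q ** Q = transpose P ** P + outer v v"
proof -
  define u where "u = matrix_inv (transpose P) *v v"
  have Pu: "transpose P *v u = v"
    using P by (simp add: u_def matrix_vector_mul_assoc matrix_inv_right transpose_invertible)
  define k where "k = sqrt (1 + u \<bullet> u)"
  \<comment> \<open>This is \<open>(k - 1) / (u \<bullet> u)\<close> after cancelling
    \<open>k - 1\<close> from \<open>u \<bullet> u = (k - 1) * (k + 1)\<close>, a form that remains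
    correct for \<open>u = 0\<close>.\<close>
  define al where "al = 1 / (1 + k)"
  have k: "k * k = 1 + u \<bullet> u" "k \<ge> 0" by (auto simp: k_def)
  have uu: "u \<bullet> u = k * k - 1" using k by simp
  have al1: "al * (1 + k) = 1" and "al \<ge> 0" using k(2) by (auto simp: al_def)
  have "2 * al + al * al * (u \<bullet> u) = 2 * al + al * (al * (1 + k)) * (k - 1)"
    unfolding uu by (simp add: algebra_simps)
  also have "al * (al * (1 + k)) * (k - 1) = al * (1 + k) - 2 * al"
    using al1 by (simp add: algebra_simps)
  finally have al: "2 * al + al * al * (u \<bullet> u) = 1" by (simp add: al1)
  define R where "R = mat 1 + al *\<^sub>R outer u u"
  have Rv: "R *v x = x + (al * (u \<bullet> x)) *\<^sub>R u" for x
    by (simp add: R_def matrix_vector_mult_add_rdistrib scaleR_matrix_vector_assoc[symmetric] outer_mult_vec)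
  have RR: "R *v (R *v x) = x + (u \<bullet> x) *\<^sub>R u" for x
  proof -
    have "R *v (R *v x) = x + ((al * (u \<bullet> x)) *\<^sub>R u + (al * (u \<bullet> x + al * (u \<bullet> x) * (u \<bullet> u))) *\<^sub>R u)"
      by (simp add: Rv inner_add_right add.assoc)
    also have "\<dots> = x + ((2 * al + al * al * (u \<bullet> u)) * (u \<bullet> x)) *\<^sub>R u"
      unfolding scaleR_left_distrib[symmetric] by (simp add: algebra_simps)
    finally have "R *v (R *v x) = x + ((2 * al + al * al * (u \<bullet> u)) * (u \<bullet> x)) *\<^sub>R u" .
    then show ?thesis by (simp only: al mult_1)
  qed
  have Rt: "transpose R = R"
    by (simp add: R_def transpose_def outer_def vec_eq_iff mat_def mult.commute)
  have "x \<bullet> (R *v x) = x \<bullet> x + al * (u \<bullet> x)\<^sup>2" for x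
    by (simp add: Rv algebra_simps power2_eq_square inner_commute)
  then have "invertible R"
    using \<open>al \<ge> 0\<close> by (intro invertible_if_positive_definite) (auto intro!: add_pos_nonneg)
  then have inv: "invertible (R ** P)" using P by (rule invertible_mult)
  have "transpose (R ** P) ** (R ** P) = transpose P ** P + outer v v"
  proof (subst matrix_eq, intro allI)
    fix x
    have "(transpose (R ** P) ** (R ** P)) *v x = transpose P *v (R *v (R *v (P *v x)))"
      by (simp add: matrix_transpose_mul Rt matrix_vector_mul_assoc matrix_mul_assoc)
    also have "\<dots> = transpose P *v (P *v x) + (u \<bullet> (P *v x)) *\<^sub>R v"
      by (simp add: RR matrix_vector_right_distrib matrix_vector_mult_scaleR Pu[simplified])
    also have "u \<bullet> (P *v x) = v \<bullet> x"
      using Pu by (metis dot_lmul_matrix inner_commute transpose_matrix_vector)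
    finally show "(transpose (R ** P) ** (R ** P)) *v x = (transpose P ** P + outer v v) *v x"
      by (simp add: matrix_vector_mult_add_rdistrib matrix_vector_mul_assoc outer_mult_vec)
  qed
  with inv show ?thesis by blast
qed

text \<open>Start from \<open>sqrt l\<close> times the identity and absorb the summands one at a
  time as rank-one updates by \<open>sqrt (c i) *\<^sub>R v i\<close>. The factor \<open>P\<close>
  serves as a square root of the matrix: it turns the quadratic form into
  \<open>(norm (P *v x))\<^sup>2\<close> and the determinant into the square of
  \<open>det P\<close>.\<close>

lemma regularized_gram_factorization:
  fixes v :: "'i \<Rightarrow> real^'n" and c :: "'i \<Rightarrow> real"
  assumes "finite I" and "\<And>i. i \<in> I \<Longrightarrow> 0 \<le> c i" and "0 < l"
  obtains P :: "real^'n^'n" where "invertible P"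
    "transpose P ** P = (\<Sum>i\<in>I. c i *\<^sub>R outer (v i) (v i)) + l *\<^sub>R mat 1"
proof -
  have "\<exists>P :: real^'n^'n. invertible P \<and> transpose P ** P = (\<Sum>i\<in>I. c i *\<^sub>R outer (v i) (v i)) + l *\<^sub>R mat 1"
    using assms
  proof (induction I rule: finite_induct)
    case empty
    let ?P = "sqrt l *\<^sub>R mat 1 :: real^'n^'n"
    have "invertible ?P"
      using \<open>0 < l\<close> by (intro invertible_if_positive_definite)
        (simp add: scaleR_matrix_vector_assoc[symmetric])
    moreover have "transpose ?P ** ?P = l *\<^sub>R mat 1"
      using \<open>0 < l\<close> by (simp add: transpose_scalar scalar_matrix_assoc[symmetric] matrix_scalar_ac scaleR_scaleR)
    ultimately show ?case by (intro exI[of _ ?P] conjI) simp_all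
  next
    case (insert i I)
    then obtain P :: "real^'n^'n" where P: "invertible P"
        "transpose P ** P = (\<Sum>i\<in>I. c i *\<^sub>R outer (v i) (v i)) + l *\<^sub>R mat 1"
      by auto
    have "outer (sqrt (c i) *\<^sub>R v i) (sqrt (c i) *\<^sub>R v i) = c i *\<^sub>R outer (v i) (v i)"
      using insert.prems by (simp add: outer_def vec_eq_iff mult_ac flip: power2_eq_square)
    with gram_rank_one_update[OF P(1), of "sqrt (c i) *\<^sub>R v i"] insert.hyps show ?case
      by (auto simp: P(2) add_ac)
  qed
  then show ?thesis using that by blast
qed

subsection \<open>Gaussian integrals over balls\<close>

text \<open>Substitute \<open>g y = (sqrt l / 2) P^{-1} y\<close>, whose Jacobian is the prefactor.
  The exponent becomes \<open>- l / 4 * (norm y)\<^sup>2\<close>, which is no smaller than the one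
  on the left, and coercivity gives \<open>norm (g y) \<le> norm y / 2\<close>, so the ball of
  radius \<open>2 * r\<close> is sent into the ball of radius \<open>r\<close>. The halving is the
  source of the term \<open>d log 2\<close> in the final bound.\<close>

lemma gaussian_ball_integral_ge:
  fixes P :: "real^'n^'n"
  assumes P: "invertible P" and "0 < l" and coercive: "\<And>x. l * (norm x)\<^sup>2 \<le> (norm (P *v x))\<^sup>2"
  shows "ennreal ((sqrt l / 2) ^ CARD('n) / \<bar>det P\<bar>) *
      (\<integral>\<^sup>+x. ennreal (exp (- l * (norm x)\<^sup>2)) * indicator (cball (0 :: real^'n) (2 * r)) x \<partial>lborel)
    \<le> (\<integral>\<^sup>+x. ennreal (exp (- (norm (P *v x))\<^sup>2)) * indicator (cball 0 r) x \<partial>lborel)"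
proof -
  define k where "k = sqrt l / 2"
  have k: "k > 0" "k * k = l / 4" using \<open>0 < l\<close> by (auto simp: k_def)
  define g where "g = (*v) (matrix_inv P) \<circ> (*\<^sub>R) k"
  have lin: "linear ((*v) (matrix_inv P))" "linear ((*\<^sub>R) k :: real^'n \<Rightarrow> _)"
    by (simp_all add: linear_scaleR)
  have ling: "linear g" unfolding g_def using lin by (rule linear_compose[rotated])
  have "det (matrix_inv P) * det P = 1"
    using P by (metis det_I det_mul matrix_inv_left)
  then have "\<bar>det (matrix_inv P)\<bar> = 1 / \<bar>det P\<bar>"
    by (metis abs_mult abs_one nonzero_eq_divide_eq mult_zero_right zero_neq_one abs_zero)
  then have det: "\<bar>det (matrix g)\<bar> = k ^ CARD('n) / \<bar>det P\<bar>"
    using k lin by (simp add: g_def matrix_compose det_mul abs_mult)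
  have Pg: "P *v g x = k *\<^sub>R x" for x
    using P by (simp add: g_def matrix_vector_mul_assoc matrix_inv_right)
  have NPg: "(norm (P *v g x))\<^sup>2 = k * k * (norm x)\<^sup>2" for x
    by (simp add: Pg power_mult_distrib power2_eq_square)
  have ng: "norm (g x) \<le> norm x / 2" for x
  proof -
    have "l * (norm (g x))\<^sup>2 \<le> (k * k) * (norm x)\<^sup>2"
      using coercive[of "g x"] by (simp only: NPg)
    also have "\<dots> = l * (norm x / 2)\<^sup>2"
      by (simp add: k(2) power_divide)
    finally have "l * (norm (g x))\<^sup>2 \<le> l * (norm x / 2)\<^sup>2" .
    then show ?thesis using \<open>0 < l\<close> by (simp add: power2_le_iff_abs_le)
  qed
  let ?f = "\<lambda>x. ennreal (exp (- (norm (P *v x))\<^sup>2)) * indicator (cball 0 r) x"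
  have [measurable]: "(*v) P \<in> borel_measurable borel"
    by (intro borel_measurable_continuous_onI matrix_vector_mult_linear_continuous_on)
  have "ennreal \<bar>det (matrix g)\<bar> *
      (\<integral>\<^sup>+x. ennreal (exp (- l * (norm x)\<^sup>2)) * indicator (cball (0 :: real^'n) (2 * r)) x \<partial>lborel)
    \<le> ennreal \<bar>det (matrix g)\<bar> * (\<integral>\<^sup>+x. ?f (g x) \<partial>lborel)"
  proof (intro mult_left_mono nn_integral_mono mult_mono)
    fix x :: "real^'n"
    have "k * k * (norm x)\<^sup>2 \<le> l * (norm x)\<^sup>2"
      using k \<open>0 < l\<close> by (intro mult_right_mono) auto
    then show "ennreal (exp (- l * (norm x)\<^sup>2)) \<le> ennreal (exp (- (norm (P *v g x))\<^sup>2))"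
      by (intro ennreal_leI) (simp add: NPg)
    show "indicator (cball 0 (2 * r)) x \<le> (indicator (cball 0 r) (g x) :: ennreal)"
      using ng[of x] by (auto simp: indicator_def)
  qed auto
  also have "\<dots> \<le> (\<integral>\<^sup>+x. ?f x \<partial>lborel)"
    using ling by (intro det_nn_integral_linear_le)
      (auto intro!: borel_measurable_times_ennreal borel_measurable_indicator borel_closed)
  finally show ?thesis by (simp add: det k_def)
qed

lemma tilted_gaussian_ball_integral_ge:
  fixes P :: "real^'n^'n"
  assumes z: "norm z \<le> r"
  shows "ennreal (exp (z \<bullet> s - (norm (P *v z))\<^sup>2)) *
      (\<integral>\<^sup>+x. ennreal (exp (- (norm (P *v x))\<^sup>2)) * indicator (cball 0 r) x \<partial>lborel)
    \<le> (\<integral>\<^sup>+x. ennreal (exp (x \<bullet> s - (norm (P *v x))\<^sup>2)) * indicator (cball 0 (2 * r)) x \<partial>lborel)"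
proof -
  have [measurable]: "(*v) P \<in> borel_measurable borel"
    by (intro borel_measurable_continuous_onI matrix_vector_mult_linear_continuous_on)
  define v where "v = s - 2 *\<^sub>R (transpose P *v (P *v z))"
  define K where "K = exp (z \<bullet> s - (norm (P *v z))\<^sup>2)"
  define G where "G x = ennreal (exp (- (norm (P *v x))\<^sup>2)) * indicator (cball 0 r) x" for x
  define E where "E x = ennreal (exp (x \<bullet> v)) * G x" for x
  have [measurable]: "G \<in> borel_measurable borel" "E \<in> borel_measurable borel"
    unfolding G_def E_def by (auto intro!: borel_measurable_times_ennreal borel_measurable_indicator borel_closed)
  have Gm: "G (- x) = G x" for x 
    by (simp add: G_def indicator_def linear_neg[OF matrix_vector_mul_linear])
  have "(\<integral>\<^sup>+x. G x \<partial>lborel) \<le> (\<integral>\<^sup>+x. ennreal (1/2) * E x + ennreal (1/2) * E (- x) \<partial>lborel)"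
  proof (rule nn_integral_mono)
    fix x
    \<comment> \<open>Average \<open>1 + u \<le> exp u\<close> over \<open>u = x \<bullet> v\<close>
      and \<open>u = - (x \<bullet> v)\<close>.\<close>
    have "1 \<le> 1/2 * exp (x \<bullet> v) + 1/2 * exp (- x \<bullet> v)"
      using exp_ge_add_one_self[of "x \<bullet> v"] exp_ge_add_one_self[of "- (x \<bullet> v)"]
      unfolding inner_minus_left by linarith
    then have "1 \<le> ennreal (1/2 * exp (x \<bullet> v) + 1/2 * exp (- x \<bullet> v))"
      by (metis ennreal_1 ennreal_leI)
    then have "G x * 1 \<le> G x * ennreal (1/2 * exp (x \<bullet> v) + 1/2 * exp (- x \<bullet> v))"
      by (intro mult_left_mono) auto
    also have "ennreal (1/2 * exp (x \<bullet> v) + 1/2 * exp (- x \<bullet> v)) =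
        ennreal (1/2) * ennreal (exp (x \<bullet> v)) + ennreal (1/2) * ennreal (exp (- x \<bullet> v))"
      by (subst ennreal_plus, simp, simp)
        (simp only: ennreal_mult exp_ge_zero zero_le_divide_1_iff zero_le_numeral)
    also have "G x * \<dots> = ennreal (1/2) * E x + ennreal (1/2) * E (- x)"
      by (simp only: E_def Gm distrib_left mult_ac)
    finally show "G x \<le> ennreal (1/2) * E x + ennreal (1/2) * E (- x)" by simp
  qed
  also have "\<dots> = ennreal (1/2) * (\<integral>\<^sup>+x. E x \<partial>lborel) + ennreal (1/2) * (\<integral>\<^sup>+x. E (- x) \<partial>lborel)"
    by (simp add: nn_integral_add nn_integral_cmult)
  also have "\<dots> = (ennreal (1/2) + ennreal (1/2)) * (\<integral>\<^sup>+x. E x \<partial>lborel)"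
    by (simp only: nn_integral_lborel_reflect[of E, simplified] distrib_right)
  also have "ennreal (1/2) + ennreal (1/2) = 1"
    by (subst ennreal_plus[symmetric]) auto
  finally have "ennreal K * (\<integral>\<^sup>+x. G x \<partial>lborel) \<le> ennreal K * (\<integral>\<^sup>+x. E x \<partial>lborel)"
    by (intro mult_left_mono) auto
  also have "\<dots> = (\<integral>\<^sup>+x. ennreal K * E x \<partial>lborel)"
    by (simp add: nn_integral_cmult)
  also have "\<dots> \<le> (\<integral>\<^sup>+x. ennreal (exp ((z + x) \<bullet> s - (norm (P *v (z + x)))\<^sup>2)) * indicator (cball 0 (2 * r)) (z + x) \<partial>lborel)"
  proof (rule nn_integral_mono)
    fix x
    have "(P *v z) \<bullet> (P *v x) = x \<bullet> (transpose P *v (P *v z))"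
      by (metis dot_lmul_matrix inner_commute transpose_matrix_vector)
    then have "(norm (P *v (z + x)))\<^sup>2 = (norm (P *v z))\<^sup>2 + (norm (P *v x))\<^sup>2 + 2 * (x \<bullet> (transpose P *v (P *v z)))"
      by (simp add: matrix_vector_right_distrib power2_norm_eq_inner algebra_simps inner_commute)
    then have "(z + x) \<bullet> s - (norm (P *v (z + x)))\<^sup>2 =
        (z \<bullet> s - (norm (P *v z))\<^sup>2) + (x \<bullet> v + - (norm (P *v x))\<^sup>2)"
      by (simp add: v_def algebra_simps)
    then have *: "ennreal (exp ((z + x) \<bullet> s - (norm (P *v (z + x)))\<^sup>2)) =
        ennreal K * (ennreal (exp (x \<bullet> v)) * ennreal (exp (- (norm (P *v x))\<^sup>2)))"
      by (simp only: exp_add K_def ennreal_mult' exp_ge_zero)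
    \<comment> \<open>The ball of radius \<open>r\<close> around \<open>z\<close> lies in the ball
      of radius \<open>2 * r\<close> around 0, because \<open>norm z \<le> r\<close>.\<close>
    have "indicator (cball 0 r) x \<le> (indicator (cball 0 (2 * r)) (z + x) :: ennreal)"
      using z norm_triangle_ineq[of z x] by (auto simp: indicator_def)
    then show "ennreal K * E x \<le> ennreal (exp ((z + x) \<bullet> s - (norm (P *v (z + x)))\<^sup>2)) * indicator (cball 0 (2 * r)) (z + x)"
      unfolding * E_def G_def by (simp add: mult.assoc mult_left_mono)
  qed
  also have "\<dots> = (\<integral>\<^sup>+x. ennreal (exp (x \<bullet> s - (norm (P *v x))\<^sup>2)) * indicator (cball 0 (2 * r)) x \<partial>lborel)"
    by (rule nn_integral_lborel_translate[where c = z and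
        f = "\<lambda>x. ennreal (exp (x \<bullet> s - (norm (P *v x))\<^sup>2)) * indicator (cball 0 (2 * r)) x"])
      (auto intro!: borel_measurable_times_ennreal borel_measurable_indicator borel_closed)
  finally show ?thesis by (simp add: K_def G_def)
qed

subsection \<open>The exponential supermartingale\<close>

lemma exp_le_quadratic:
  fixes x :: real
  assumes "\<bar>x\<bar> \<le> 1"
  shows "exp x \<le> 1 + x + x\<^sup>2"
proof (cases "0 \<le> x")
  case True
  then show ?thesis using assms by (intro exp_bound) auto
next
  case False
  define y where "y = - x"
  have y: "0 < y" "y \<le> 1" using False assms by (auto simp: y_def)
  \<comment> \<open>This is the claim multiplied by \<open>exp y\<close>, with \<open>exp y\<close>
    replaced by its lower bound \<open>1 + y + y\<^sup>2 / 2\<close>. The linear terms cancel in the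
    product and the remaining coefficients are nonnegative.\<close>
  have "1 \<le> (1 - y + y\<^sup>2) * (1 + y + y\<^sup>2 / 2)"
  proof -
    have "(1 - y + y\<^sup>2) * (1 + y + y\<^sup>2 / 2) = 1 + y\<^sup>2 / 2 + y ^ 3 / 2 + y ^ 4 / 2"
      by (simp add: field_simps power2_eq_square power3_eq_cube power4_eq_xxxx)
    then show ?thesis using y by simp
  qed
  also have "\<dots> \<le> (1 - y + y\<^sup>2) * exp y"
    using y exp_lower_Taylor_quadratic[of y] by (intro mult_left_mono) (auto simp: field_simps intro: add_increasing2)
  finally have "exp (- y) \<le> 1 - y + y\<^sup>2"
    by (simp add: exp_minus divide_simps)
  then show ?thesis by (simp add: y_def)
qed

text \<open>Each factor has conditional mean at most
  \<open>(1 + y\<^sup>2 v) exp (- y\<^sup>2 v) \<le> 1\<close>, where \<open>v\<close> is the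
  conditional second moment: \<open>b * m \<le> 1\<close> keeps \<open>y e\<close> in the range of
  the quadratic bound on \<open>exp\<close>, and the linear term has conditional mean zero. Later
  \<open>y s\<close> is \<open>w s * (\<xi> \<bullet> a s)\<close> for a fixed direction
  \<xi>.\<close>

lemma exp_martingale_transform_le_1:
  fixes M :: "'a measure" and F :: "nat \<Rightarrow> 'a measure" and y e :: "nat \<Rightarrow> 'a \<Rightarrow> real"
  assumes "prob_space M"
    and sub: "\<And>u. 1 \<le> u \<Longrightarrow> u \<le> Suc n \<Longrightarrow> sigma_finite_subalgebra M (F u)"
    and mono: "\<And>u v. 1 \<le> u \<Longrightarrow> u \<le> v \<Longrightarrow> v \<le> Suc n \<Longrightarrow> sets (F u) \<subseteq> sets (F v)"
    and y_meas: "\<And>u. 1 \<le> u \<Longrightarrow> u \<le> n \<Longrightarrow> y u \<in> borel_measurable (F u)"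
    and y_bdd: "\<And>u x. 1 \<le> u \<Longrightarrow> u \<le> n \<Longrightarrow> x \<in> space M \<Longrightarrow> \<bar>y u x\<bar> \<le> b"
    and e_meas: "\<And>u. 1 \<le> u \<Longrightarrow> u \<le> n \<Longrightarrow> e (u + 1) \<in> borel_measurable (F (u + 1))"
    and e_mds: "\<And>u. 1 \<le> u \<Longrightarrow> u \<le> n \<Longrightarrow> AE x in M. real_cond_exp M (F u) (e (u + 1)) x = 0"
    and e_bdd: "\<And>u. 1 \<le> u \<Longrightarrow> u \<le> n \<Longrightarrow> AE x in M. \<bar>e (u + 1) x\<bar> \<le> m"
    and bm: "b * m \<le> 1"
  shows "(\<integral>\<^sup>+x. ennreal (exp (\<Sum>s = 1..n. y s x * e (s + 1) x
      - (y s x)\<^sup>2 * real_cond_exp M (F s) (\<lambda>x. (e (s + 1) x)\<^sup>2) x)) \<partial>M) \<le> 1"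
proof -
  interpret prob_space M by fact
  define v where "v u = real_cond_exp M (F u) (\<lambda>x. (e (u + 1) x)\<^sup>2)" for u
  define Z where "Z k x = exp (\<Sum>s = 1..k. y s x * e (s + 1) x - (y s x)\<^sup>2 * v s x)" for k x
  have Z_nonneg: "0 \<le> Z k x" for k x by (simp add: Z_def)
  have F_sub: "subalgebra M (F u)" if "1 \<le> u" "u \<le> Suc n" for u
    using sub[OF that] by (simp add: sigma_finite_subalgebra.subalg)
  have subF: "subalgebra (F v) (F u)" if "1 \<le> u" "u \<le> v" "v \<le> Suc n" for u v
    using F_sub[of u] F_sub[of v] mono[OF that] that by (auto simp: subalgebra_def)
  have yM: "y u \<in> borel_measurable M" "e (u + 1) \<in> borel_measurable M" if "1 \<le> u" "u \<le> n" for u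
    using that by (auto intro!: measurable_from_subalg[OF F_sub y_meas] measurable_from_subalg[OF F_sub[of "u + 1"] e_meas[of u], simplified])
  have v_meas: "v u \<in> borel_measurable (F u)" for u
    by (simp add: v_def borel_measurable_cond_exp)
  have v_nonneg: "AE x in M. 0 \<le> v u x" if "1 \<le> u" "u \<le> n" for u
  proof -
    interpret sigma_finite_subalgebra M "F u" using sub that by simp
    show ?thesis unfolding v_def using yM[OF that] by (intro real_cond_exp_pos) auto
  qed
  have ye: "AE x in M. \<bar>y u x * e (u + 1) x\<bar> \<le> 1" if "1 \<le> u" "u \<le> n" for u
    using e_bdd[OF that] AE_space
  proof eventually_elim
    case (elim x)
    have "\<bar>y u x * e (u + 1) x\<bar> \<le> b * m"
      unfolding abs_mult using y_bdd[OF that elim(2)] elim(1) by (intro mult_mono) auto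
    with bm show ?case by simp
  qed
  \<comment> \<open>The last noise term in \<open>Z k\<close> is \<open>e (k + 1)\<close>, hence
    \<open>F (Suc k)\<close>, which is also the past of the next factor.\<close>
  have Z_meas: "Z k \<in> borel_measurable (F (Suc k))" if "k \<le> n" for k
  proof -
    have *: "y s \<in> borel_measurable (F (Suc k))" "v s \<in> borel_measurable (F (Suc k))"
        "e (s + 1) \<in> borel_measurable (F (Suc k))" if "s \<in> {1..k}" for s
      using that \<open>k \<le> n\<close>
      by (auto intro!: measurable_from_subalg[OF subF y_meas] measurable_from_subalg[OF subF v_meas]
          measurable_from_subalg[OF subF e_meas, simplified])
    have "(\<lambda>x. y s x * e (s + 1) x - (y s x)\<^sup>2 * v s x) \<in> borel_measurable (F (Suc k))"
      if "s \<in> {1..k}" for s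
    proof -
      note *[OF that, measurable]
      show ?thesis by measurable
    qed
    then have "(\<lambda>x. \<Sum>s = 1..k. y s x * e (s + 1) x - (y s x)\<^sup>2 * v s x) \<in> borel_measurable (F (Suc k))"
      by (rule borel_measurable_sum)
    then show ?thesis unfolding Z_def by measurable
  qed
  \<comment> \<open>The almost sure bound is carried through the induction to supply integrability
    of the products below. It grows by \<open>exp 1\<close> per step, since \<open>v \<ge> 0\<close>
    and \<open>\<bar>y e\<bar> \<le> 1\<close> almost surely.\<close>
  have "integrable M (Z k) \<and> (\<integral>x. Z k x \<partial>M) \<le> 1 \<and> (AE x in M. Z k x \<le> exp (real k))" if "k \<le> n" for k
    using that
  proof (induction k)
    case 0
    show ?case by (simp add: Z_def prob_space)
  next
    case (Suc k)
    then have IH: "integrable M (Z k)" "(\<integral>x. Z k x \<partial>M) \<le> 1" "AE x in M. Z k x \<le> exp (real k)"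
      and k: "1 \<le> Suc k" "Suc k \<le> n" by auto
    let ?F = "F (Suc k)" and ?y = "y (Suc k)" and ?e = "e (Suc k + 1)" and ?v = "v (Suc k)"
    interpret sigma_finite_subalgebra M ?F using sub k by simp
    note F = measurable_from_subalg[OF subalg]
    \<comment> \<open>\<open>X\<close> is the part of \<open>Z (Suc k)\<close> known at time
      \<open>Suc k\<close>. In products with \<open>X\<close> and \<open>?y\<close> the new noise
      \<open>?e\<close> may therefore be replaced by its conditional expectation under the
      integral.\<close>
    define X where "X x = Z k x * exp (- ((?y x)\<^sup>2 * ?v x))" for x
    have [measurable]: "Z k \<in> borel_measurable ?F" "?y \<in> borel_measurable ?F" "?v \<in> borel_measurable ?F"
      using Z_meas y_meas v_meas k by auto
    have XF [measurable]: "X \<in> borel_measurable ?F" unfolding X_def by measurable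
    have [measurable]: "X \<in> borel_measurable M" "?y \<in> borel_measurable M" "?v \<in> borel_measurable M"
        "?e \<in> borel_measurable M" "Z k \<in> borel_measurable M"
      using F[OF XF] yM[OF k] F[OF v_meas[of "Suc k"]] IH by auto
    have X0: "0 \<le> X x" for x by (simp add: X_def Z_def)
    have XB: "AE x in M. X x \<le> exp (real k)"
      using IH(3) v_nonneg[OF k]
    proof eventually_elim
      case (elim x)
      have "X x \<le> Z k x * 1"
        unfolding X_def using elim by (intro mult_left_mono) (auto simp: Z_def)
      with elim show ?case by simp
    qed
    have step: "Z (Suc k) x = X x * exp (?y x * ?e x)" for x
      by (simp add: X_def Z_def flip: exp_add)
    have bound: "AE x in M. Z (Suc k) x \<le> exp (real (Suc k))"
      using XB ye[OF k]
    proof eventually_elim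
      case (elim x)
      have "X x * exp (?y x * ?e x) \<le> exp (real k) * exp 1"
        using elim X0 by (intro mult_mono) auto
      then show ?case by (simp add: step exp_add[symmetric] add.commute)
    qed
    have int: "integrable M (\<lambda>x. X x * h x)"
      if [measurable]: "h \<in> borel_measurable M" and "AE x in M. \<bar>h x\<bar> \<le> 1" for h
    proof (rule integrable_const_bound[where B = "exp (real k)"])
      show "AE x in M. norm (X x * h x) \<le> exp (real k)"
        using XB that(2)
      proof eventually_elim
        case (elim x)
        then show ?case using X0[of x] mult_mono[of "X x" "exp (real k)" "\<bar>h x\<bar>" 1]
          by (simp add: abs_mult)
      qed
    qed measurable
    have ye1: "AE x in M. \<bar>?y x * ?e x\<bar> \<le> 1" "AE x in M. \<bar>(?y x * ?e x)\<^sup>2\<bar> \<le> 1"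
      using ye[OF k] by (auto simp: abs_square_le_1)
    have i0: "integrable M X" using int[of "\<lambda>_. 1"] by simp
    have "integrable M (\<lambda>x. X x * (?y x * ?e x))" "integrable M (\<lambda>x. X x * (?y x * ?e x)\<^sup>2)"
      by (rule int[OF _ ye1(1)], measurable) (rule int[OF _ ye1(2)], measurable)
    then have i1: "integrable M (\<lambda>x. (X x * ?y x) * ?e x)"
      and i2: "integrable M (\<lambda>x. (X x * (?y x)\<^sup>2) * (?e x)\<^sup>2)"
      by (simp_all add: mult.assoc power_mult_distrib)
    have e1: "(\<integral>x. (X x * ?y x) * ?e x \<partial>M) = 0"
    proof -
      have "(\<integral>x. (X x * ?y x) * ?e x \<partial>M) = (\<integral>x. (X x * ?y x) * real_cond_exp M ?F ?e x \<partial>M)"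
        by (rule real_cond_exp_intg(2)[symmetric, OF i1]) measurable
      also have "\<dots> = (\<integral>x. 0 \<partial>M)"
        using e_mds[OF k] by (intro integral_cong_AE) auto
      finally show ?thesis by simp
    qed
    have e2: "integrable M (\<lambda>x. (X x * (?y x)\<^sup>2) * ?v x)"
        "(\<integral>x. (X x * (?y x)\<^sup>2) * (?e x)\<^sup>2 \<partial>M) = (\<integral>x. (X x * (?y x)\<^sup>2) * ?v x \<partial>M)"
      unfolding v_def
      by (rule real_cond_exp_intg(1)[OF i2], measurable)
        (rule real_cond_exp_intg(2)[symmetric, OF i2], measurable)
    have intZ: "integrable M (Z (Suc k))"
    proof (rule integrable_const_bound)
      show "AE x in M. norm (Z (Suc k) x) \<le> exp (real (Suc k))"
        using bound by (simp add: Z_def)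
      show "Z (Suc k) \<in> borel_measurable M"
        using k by (intro measurable_from_subalg[OF F_sub[of "Suc (Suc k)"] Z_meas]) auto
    qed
    have "(\<integral>x. Z (Suc k) x \<partial>M) \<le> (\<integral>x. X x + (X x * ?y x) * ?e x + (X x * (?y x)\<^sup>2) * (?e x)\<^sup>2 \<partial>M)"
    proof (rule integral_mono_AE[OF intZ])
      show "AE x in M. Z (Suc k) x \<le> X x + (X x * ?y x) * ?e x + (X x * (?y x)\<^sup>2) * (?e x)\<^sup>2"
        using ye[OF k]
      proof eventually_elim
        case (elim x)
        have "X x * exp (?y x * ?e x) \<le> X x * (1 + ?y x * ?e x + (?y x * ?e x)\<^sup>2)"
          using elim X0 by (intro mult_left_mono exp_le_quadratic) auto
        then show ?case by (simp add: step algebra_simps power_mult_distrib)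
      qed
    qed (use i0 i1 i2 in auto)
    also have "\<dots> = (\<integral>x. X x \<partial>M) + (\<integral>x. (X x * (?y x)\<^sup>2) * ?v x \<partial>M)"
      using i0 i1 i2 e1 e2(2) by simp
    also have "\<dots> = (\<integral>x. X x + (X x * (?y x)\<^sup>2) * ?v x \<partial>M)"
      using i0 e2(1) by simp
    also have "\<dots> \<le> (\<integral>x. Z k x \<partial>M)"
    proof (rule integral_mono)
      fix x
      \<comment> \<open>Here \<open>1 + u \<le> exp u\<close> with
        \<open>u = (?y x)\<^sup>2 * ?v x\<close> cancels the compensator in \<open>X\<close> and
        brings back \<open>Z k\<close>.\<close>
      have "X x + (X x * (?y x)\<^sup>2) * ?v x = X x * (1 + (?y x)\<^sup>2 * ?v x)"
        by (simp add: algebra_simps)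
      also have "\<dots> \<le> X x * exp ((?y x)\<^sup>2 * ?v x)"
        using X0 by (intro mult_left_mono) auto
      also have "\<dots> = Z k x"
        by (simp add: X_def mult.assoc flip: exp_add)
      finally show "X x + (X x * (?y x)\<^sup>2) * ?v x \<le> Z k x" .
    qed (use i0 e2(1) IH(1) in auto)
    also note IH(2)
    finally show ?case using intZ bound by simp
  qed
  from this[of n] have "integrable M (Z n)" "(\<integral>x. Z n x \<partial>M) \<le> 1" by auto
  then have "(\<integral>\<^sup>+x. ennreal (Z n x) \<partial>M) \<le> 1"
    by (subst nn_integral_eq_integral) (simp_all add: Z_nonneg)
  then show ?thesis by (simp add: Z_def v_def)
qed

subsection \<open>The mixture bound\<close>

text \<open>Chaining the two ball estimates bounds \<open>?I\<close> below by \<open>exp (z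
  \<bullet> s - (norm (P *v z))\<^sup>2) * (sqrt l / 2) ^ d / \<bar>det P\<bar>\<close> times
  \<open>?N\<close>; the threshold in \<open>large\<close> is exactly what makes this prefactor at
  least \<open>1 / \<delta>\<close>. No probability enters: it is applied separately at each sample
  point.\<close>

lemma truncated_mixture_ge:
  fixes P :: "real^'n^'n" and s :: "real^'n"
  assumes P: "invertible P" and l: "0 < l" and r: "0 < r" and \<delta>: "0 < \<delta>"
    and coercive: "\<And>x. l * (norm x)\<^sup>2 \<le> (norm (P *v x))\<^sup>2"
    and H: "H = transpose P ** P" and \<beta>: "\<beta> = sqrt l * r"
    and large: "mat_norm (matrix_inv H) s \<ge> \<beta>
        + 1 / \<beta> * ln (sqrt (det H) / (\<delta> * l powr (real CARD('n) / 2)))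
        + 1 / \<beta> * real CARD('n) * ln 2"
  shows "(\<integral>\<^sup>+x. ennreal (exp (- l * (norm x)\<^sup>2)) * indicator (cball (0 :: real^'n) (2 * r)) x \<partial>lborel)
    \<le> ennreal \<delta> * (\<integral>\<^sup>+x. ennreal (exp (x \<bullet> s - (norm (P *v x))\<^sup>2)) * indicator (cball 0 (2 * r)) x \<partial>lborel)"
    (is "?N \<le> _ * ?I")
proof -
  define d where "d = CARD('n)"
  define q where "q = mat_norm (matrix_inv H) s"
  define y where "y = matrix_inv H *v s"
  \<comment> \<open>The direction \<open>H^{-1} s\<close> is scaled so that
    \<open>norm (P *v z) = \<beta>\<close>, giving the exponent
    \<open>\<beta> * q - \<beta>\<^sup>2\<close>. Coercivity then yields
    \<open>norm z \<le> \<beta> / sqrt l = r\<close>, whence the choice of \<beta>.\<close>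
  define z where "z = (\<beta> / q) *\<^sub>R y"
  have \<beta>0: "\<beta> > 0" using l r by (simp add: \<beta>)
  have detP: "det P \<noteq> 0" using P by (simp add: invertible_det_nz)
  have "invertible H" using P by (simp add: H invertible_mult transpose_invertible)
  then have "H *v y = s"
    by (simp add: y_def matrix_vector_mul_assoc matrix_inv_right)
  then have "s \<bullet> y = (transpose P *v (P *v y)) \<bullet> y"
    by (simp only: H matrix_vector_mul_assoc)
  also have "\<dots> = (norm (P *v y))\<^sup>2"
    by (simp add: power2_norm_eq_inner dot_lmul_matrix)
  finally have sy: "s \<bullet> y = (norm (P *v y))\<^sup>2" .
  then have q: "q = norm (P *v y)"
    by (simp add: q_def mat_norm_def flip: y_def)
  \<comment> \<open>The quotient is left unsimplified because of \<open>q = 0\<close>, where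
    division by zero makes \<open>z = 0\<close>. The bound by \<beta> and
    \<open>z \<bullet> s = \<beta> * q\<close> below hold in that case too.\<close>
  have Pz: "norm (P *v z) = \<beta> / q * q"
    using \<beta>0 by (simp add: z_def q matrix_vector_mult_scaleR)
  have Pz_le: "norm (P *v z) \<le> \<beta>" using \<beta>0 by (simp add: Pz)
  have "l * (norm z)\<^sup>2 \<le> \<beta>\<^sup>2"
    using coercive[of z] Pz_le by (meson norm_ge_zero order_trans power_mono)
  then have z_le: "norm z \<le> r"
    using l r by (simp add: \<beta> power_mult_distrib power2_le_iff_abs_le)
  have "z \<bullet> s = \<beta> * q"
    using sy by (simp add: z_def inner_commute q power2_eq_square)
  then have "\<beta> * q - \<beta>\<^sup>2 \<le> z \<bullet> s - (norm (P *v z))\<^sup>2"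
    using power_mono[OF Pz_le, of 2] by simp
  moreover have "\<beta> * (1 / \<beta> * ln (sqrt (det H) / (\<delta> * l powr (real d / 2))) + 1 / \<beta> * real d * ln 2)
      \<le> \<beta> * (q - \<beta>)"
    using large \<beta>0 by (intro mult_left_mono) (auto simp: q_def d_def)
  ultimately have "ln (sqrt (det H) / (\<delta> * l powr (real d / 2))) + real d * ln 2
      \<le> z \<bullet> s - (norm (P *v z))\<^sup>2"
    using \<beta>0 by (simp add: algebra_simps power2_eq_square)
  moreover have "sqrt (det H) = \<bar>det P\<bar>"
    by (simp add: H det_mul)
  moreover have "l powr (real d / 2) = sqrt l ^ d"
    using l by (simp add: powr_half_sqrt[symmetric] powr_powr flip: powr_realpow)
  ultimately have "ln (\<bar>det P\<bar> / (\<delta> * sqrt l ^ d) * 2 ^ d) \<le> z \<bullet> s - (norm (P *v z))\<^sup>2"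
    using l \<delta> detP by (subst ln_mult) (auto simp: ln_realpow)
  then have K: "\<bar>det P\<bar> / (\<delta> * sqrt l ^ d) * 2 ^ d \<le> exp (z \<bullet> s - (norm (P *v z))\<^sup>2)"
    using l \<delta> detP by (subst (asm) exp_le_cancel_iff[symmetric]) (simp add: exp_add)
  let ?G = "\<integral>\<^sup>+x. ennreal (exp (- (norm (P *v x))\<^sup>2)) * indicator (cball 0 r) x \<partial>lborel"
  \<comment> \<open>The lower bound \<open>K\<close> on the tilt and the Jacobian factor cancel up
    to \<delta>: this is how the determinant and \<open>2 ^ d\<close> in the threshold were
    chosen.\<close>
  have one: "\<delta> * (\<bar>det P\<bar> / (\<delta> * sqrt l ^ d) * 2 ^ d) * ((sqrt l / 2) ^ d / \<bar>det P\<bar>) = 1"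
    using l \<delta> detP by (simp add: power_divide)
  have "?N = ennreal (\<delta> * (\<bar>det P\<bar> / (\<delta> * sqrt l ^ d) * 2 ^ d) * ((sqrt l / 2) ^ d / \<bar>det P\<bar>)) * ?N"
    by (simp only: one ennreal_1 mult_1)
  also have "\<dots> = ennreal \<delta> * (ennreal (\<bar>det P\<bar> / (\<delta> * sqrt l ^ d) * 2 ^ d)
      * (ennreal ((sqrt l / 2) ^ d / \<bar>det P\<bar>) * ?N))"
    using l \<delta> by (subst ennreal_mult, simp, simp, subst ennreal_mult) (simp_all add: mult.assoc)
  also have "\<dots> \<le> ennreal \<delta> * (ennreal (exp (z \<bullet> s - (norm (P *v z))\<^sup>2)) * ?G)"
    using gaussian_ball_integral_ge[OF P l coercive, of r] K
    by (intro mult_left_mono mult_mono ennreal_leI) (auto simp: d_def)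
  also have "\<dots> \<le> ennreal \<delta> * ?I"
    by (intro mult_left_mono tilted_gaussian_ball_integral_ge z_le) simp
  finally show ?thesis .
qed



section \<open>Averaging over directions, Markov's inequality and the exceptional null set\<close>

theorem theorem3:
  fixes M :: "'a measure" and F :: "nat \<Rightarrow> 'a measure"
    and a :: "nat \<Rightarrow> 'a \<Rightarrow> real^'d" and eps :: "nat \<Rightarrow> 'a \<Rightarrow> real"
    and w lam :: "nat \<Rightarrow> real" and t :: nat and m \<delta> :: real
  assumes "prob_space M"
    and "t \<ge> 2"
    and "m > 0"
    and filt_sub: "\<And>u. 1 \<le> u \<Longrightarrow> u \<le> t \<Longrightarrow> sigma_finite_subalgebra M (F u)"
    and filt_mono: "\<And>u v. 1 \<le> u \<Longrightarrow> u \<le> v \<Longrightarrow> v \<le> t \<Longrightarrow> sets (F u) \<subseteq> sets (F v)"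
    and a_meas: "\<And>u. 1 \<le> u \<Longrightarrow> u \<le> t \<Longrightarrow> a u \<in> borel_measurable (F u)"
    and a_bdd: "\<And>u x. 1 \<le> u \<Longrightarrow> u \<le> t \<Longrightarrow> x \<in> space M \<Longrightarrow> norm (a u x) \<le> 1"
    and eps_meas: "\<And>u. 1 \<le> u \<Longrightarrow> u + 1 \<le> t \<Longrightarrow> eps (u + 1) \<in> borel_measurable (F (u + 1))"
    and eps_mds: "\<And>u. 1 \<le> u \<Longrightarrow> u + 1 \<le> t \<Longrightarrow>
                    AE x in M. real_cond_exp M (F u) (eps (u + 1)) x = 0"
    and eps_bdd: "\<And>u. 1 \<le> u \<Longrightarrow> u + 1 \<le> t \<Longrightarrow> AE x in M. \<bar>eps (u + 1) x\<bar> \<le> m"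
    and w_pos: "\<And>u. 1 \<le> u \<Longrightarrow> w u > 0"
    and w_mono: "\<And>u v. 1 \<le> u \<Longrightarrow> u \<le> v \<Longrightarrow> w u \<le> w v"
    and lam_pos: "\<And>u. 1 \<le> u \<Longrightarrow> lam u > 0"
    and "0 < \<delta>" and "\<delta> \<le> 1"
  shows
    "let sigma2 = (\<lambda>u. real_cond_exp M (F u) (\<lambda>x. (eps (u + 1) x)\<^sup>2));
         H = (\<lambda>x. (\<Sum>s = 1..t - 1. ((w s)\<^sup>2 * sigma2 s x) *\<^sub>R outer (a s x) (a s x))
                   + lam (t - 1) *\<^sub>R mat 1);
         S = (\<lambda>x. \<Sum>s = 1..t - 1. (w s * eps (s + 1) x) *\<^sub>R a s x);
         c = 2 * m * w (t - 1) / sqrt (lam (t - 1))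
     in \<exists>A \<in> sets M. prob_space.prob M A \<le> \<delta> \<and>
          {x \<in> space M.
             mat_norm (matrix_inv (H x)) (S x)
               \<ge> sqrt (lam (t - 1)) / (2 * m * w (t - 1))
                 + c * ln (sqrt (det (H x)) / (\<delta> * lam (t - 1) powr (real CARD('d) / 2)))
                 + c * real CARD('d) * ln 2} \<subseteq> A"
proof -
  interpret prob_space M by fact
  define n where "n = t - 1"
  have n: "t = Suc n" "1 \<le> n" using \<open>t \<ge> 2\<close> by (auto simp: n_def)
  define \<sigma> where "\<sigma> u = real_cond_exp M (F u) (\<lambda>x. (eps (u + 1) x)\<^sup>2)" for u
  define H where "H x = (\<Sum>s = 1..n. ((w s)\<^sup>2 * \<sigma> s x) *\<^sub>R outer (a s x) (a s x)) + lam n *\<^sub>R mat 1" for x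
  define S where "S x = (\<Sum>s = 1..n. (w s * eps (s + 1) x) *\<^sub>R a s x)" for x
  define l where "l = lam n"
  define r where "r = 1 / (2 * m * w n)"
  \<comment> \<open>\<beta> is the first summand of the threshold and \<open>1 / \<beta>\<close> is
    its coefficient \<open>c\<close>.\<close>
  define \<beta> where "\<beta> = sqrt l * r"
  have pos: "0 < l" "0 < w n" "0 < r" "0 < \<beta>"
    using lam_pos w_pos n \<open>m > 0\<close> by (auto simp: l_def r_def \<beta>_def)
  have F_sub: "subalgebra M (F u)" if "1 \<le> u" "u \<le> t" for u
    using filt_sub[OF that] by (simp add: sigma_finite_subalgebra.subalg)
  have meas: "a u \<in> borel_measurable M" "eps (u + 1) \<in> borel_measurable M" "\<sigma> u \<in> borel_measurable M"
    if "u \<in> {1..n}" for u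
    using that n measurable_from_subalg[OF F_sub[of u] a_meas[of u]]
      measurable_from_subalg[OF F_sub[of "u + 1"] eps_meas[of u]]
    by (auto simp: \<sigma>_def borel_measurable_cond_exp2)
  define \<Phi> where "\<Phi> \<xi> x = exp (\<Sum>s = 1..n. (w s * (\<xi> \<bullet> a s x)) * eps (s + 1) x
      - (w s * (\<xi> \<bullet> a s x))\<^sup>2 * \<sigma> s x)" for \<xi> x
  \<comment> \<open>The weight is left unnormalized; its total mass is \<open>N\<close> below, and
    the division by \<open>N\<close> happens in the definition of \<open>B\<close>.\<close>
  define \<rho> where "\<rho> \<xi> = ennreal (exp (- l * (norm \<xi>)\<^sup>2)) * indicator (cball 0 (2 * r)) \<xi>" for \<xi> :: "real^'d"
  define \<Psi> where "\<Psi> x = (\<integral>\<^sup>+\<xi>. \<rho> \<xi> * ennreal (\<Phi> \<xi> x) \<partial>lborel)" for x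
  have \<rho>_meas [measurable]: "\<rho> \<in> borel_measurable borel"
    unfolding \<rho>_def by (auto intro!: borel_measurable_times_ennreal borel_measurable_indicator borel_closed)
  have \<Phi>_meas [measurable]: "(\<lambda>p. \<Phi> (fst p) (snd p)) \<in> borel_measurable (lborel \<Otimes>\<^sub>M M)"
  proof -
    have "(\<lambda>p. (w s * (fst p \<bullet> a s (snd p))) * eps (s + 1) (snd p)
        - (w s * (fst p \<bullet> a s (snd p)))\<^sup>2 * \<sigma> s (snd p)) \<in> borel_measurable (lborel \<Otimes>\<^sub>M M)"
      if "s \<in> {1..n}" for s
    proof -
      note meas[OF that, measurable]
      show ?thesis by measurable
    qed
    then have "(\<lambda>p. \<Sum>s = 1..n. (w s * (fst p \<bullet> a s (snd p))) * eps (s + 1) (snd p)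
        - (w s * (fst p \<bullet> a s (snd p)))\<^sup>2 * \<sigma> s (snd p)) \<in> borel_measurable (lborel \<Otimes>\<^sub>M M)"
      by (rule borel_measurable_sum)
    then show ?thesis unfolding \<Phi>_def by measurable
  qed
  have joint: "case_prod (\<lambda>\<xi> x. \<rho> \<xi> * ennreal (\<Phi> \<xi> x)) \<in> borel_measurable (lborel \<Otimes>\<^sub>M M)"
    unfolding case_prod_beta by measurable
  have \<Phi>_section: "(\<lambda>x. \<Phi> \<xi> x) \<in> borel_measurable M" for \<xi>
    using measurable_compose[OF measurable_Pair1' \<Phi>_meas, of \<xi>] by simp
  have [measurable]: "\<Psi> \<in> borel_measurable M"
  proof -
    have "case_prod (\<lambda>x \<xi>. \<rho> \<xi> * ennreal (\<Phi> \<xi> x)) \<in> borel_measurable (M \<Otimes>\<^sub>M lborel)"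
      using measurable_compose[OF measurable_pair_swap' joint] by (simp add: case_prod_beta)
    then show ?thesis
      unfolding \<Psi>_def by (rule lborel.borel_measurable_nn_integral)
  qed
  have \<Phi>_le: "(\<integral>\<^sup>+x. ennreal (\<Phi> \<xi> x) \<partial>M) \<le> 1" if "norm \<xi> \<le> 2 * r" for \<xi>
    unfolding \<Phi>_def \<sigma>_def
  proof (rule exp_martingale_transform_le_1[where b = "1 / m" and m = m])
    fix u x assume u: "1 \<le> u" "u \<le> n" and x: "x \<in> space M"
    \<comment> \<open>On the ball \<open>norm \<xi> \<le> 2 * r = 1 / (m * w n)\<close>,
      Cauchy-Schwarz and \<open>w u \<le> w n\<close> bound the multiplier by \<open>1 / m\<close>,
      so its product with the noise stays in \<open>[-1, 1]\<close> almost surely.\<close>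
    have "\<bar>\<xi> \<bullet> a u x\<bar> \<le> norm \<xi> * norm (a u x)" by (rule Cauchy_Schwarz_ineq2)
    also have "\<dots> \<le> 2 * r * 1"
      using a_bdd[of u x] u x n that pos by (intro mult_mono) auto
    finally have "\<bar>w u * (\<xi> \<bullet> a u x)\<bar> \<le> w n * (2 * r)"
      unfolding abs_mult using w_pos[of u] w_mono[of u n] u pos by (intro mult_mono) auto
    then show "\<bar>w u * (\<xi> \<bullet> a u x)\<bar> \<le> 1 / m"
      using pos \<open>m > 0\<close> by (simp add: r_def)
  next
    fix u assume u: "1 \<le> u" "u \<le> n"
    then have [measurable]: "a u \<in> borel_measurable (F u)" using a_meas n by simp
    show "(\<lambda>x. w u * (\<xi> \<bullet> a u x)) \<in> borel_measurable (F u)" by measurable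
  qed (use n filt_sub filt_mono eps_meas eps_mds eps_bdd \<open>prob_space M\<close> \<open>m > 0\<close> in auto)
  define N where "N = (\<integral>\<^sup>+\<xi>. \<rho> \<xi> \<partial>lborel)"
  \<comment> \<open>Tonelli exchanges the averages over directions and samples, so the bound for
    each fixed \<xi> passes to the mixture.\<close>
  have "(\<integral>\<^sup>+x. \<Psi> x \<partial>M) = (\<integral>\<^sup>+\<xi>. (\<integral>\<^sup>+x. \<rho> \<xi> * ennreal (\<Phi> \<xi> x) \<partial>M) \<partial>lborel)"
  proof -
    interpret pair_sigma_finite "lborel :: (real^'d) measure" M ..
    show ?thesis unfolding \<Psi>_def by (rule Fubini'[OF joint])
  qed
  also have "\<dots> = (\<integral>\<^sup>+\<xi>. \<rho> \<xi> * (\<integral>\<^sup>+x. ennreal (\<Phi> \<xi> x) \<partial>M) \<partial>lborel)"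
    by (intro nn_integral_cong nn_integral_cmult) (use \<Phi>_section in measurable)
  also have "\<dots> \<le> (\<integral>\<^sup>+\<xi>. \<rho> \<xi> * 1 \<partial>lborel)"
  proof (rule nn_integral_mono)
    fix \<xi> :: "real^'d"
    show "\<rho> \<xi> * (\<integral>\<^sup>+x. ennreal (\<Phi> \<xi> x) \<partial>M) \<le> \<rho> \<xi> * 1"
    proof (cases "norm \<xi> \<le> 2 * r")
      case True
      then show ?thesis by (intro mult_left_mono \<Phi>_le) auto
    qed (simp add: \<rho>_def)
  qed
  finally have \<Psi>_le: "(\<integral>\<^sup>+x. \<Psi> x \<partial>M) \<le> N" by (simp add: N_def)
  \<comment> \<open>Dividing by \<open>N\<close> requires it to be finite and positive. On the ball
    the weight lies between \<open>exp (- l * (2 * r)\<^sup>2)\<close> and 1, and the ball has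
    finite positive volume.\<close>
  have ball: "emeasure lborel (cball (0 :: real^'d) (2 * r)) = ennreal (measure lborel (cball (0 :: real^'d) (2 * r)))"
    using emeasure_lborel_cball_finite[of "0 :: real^'d" "2 * r"]
    by (intro emeasure_eq_ennreal_measure) auto
  have ball_pos: "0 < measure lborel (cball (0 :: real^'d) (2 * r))"
    using pos by (intro content_cball_pos) simp
  have "N \<le> (\<integral>\<^sup>+\<xi>. indicator (cball (0 :: real^'d) (2 * r)) \<xi> \<partial>lborel)"
    unfolding N_def \<rho>_def using pos
    by (intro nn_integral_mono) (auto simp: indicator_def ennreal_le_1)
  also have "\<dots> < \<infinity>"
    by (simp add: ball)
  finally have "N < \<infinity>" .
  have "0 < ennreal (exp (- l * (2 * r)\<^sup>2)) * emeasure lborel (cball (0 :: real^'d) (2 * r))"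
    using ball_pos by (simp add: ball ennreal_zero_less_mult_iff)
  also have "\<dots> = (\<integral>\<^sup>+\<xi>. ennreal (exp (- l * (2 * r)\<^sup>2)) * indicator (cball (0 :: real^'d) (2 * r)) \<xi> \<partial>lborel)"
    by (simp add: nn_integral_cmult_indicator)
  also have "\<dots> \<le> N"
    unfolding N_def
  proof (rule nn_integral_mono)
    fix \<xi> :: "real^'d"
    have "norm \<xi> \<le> 2 * r \<Longrightarrow> l * (norm \<xi>)\<^sup>2 \<le> l * (2 * r)\<^sup>2"
      using pos by (intro mult_left_mono power_mono) auto
    then show "ennreal (exp (- l * (2 * r)\<^sup>2)) * indicator (cball 0 (2 * r)) \<xi> \<le> \<rho> \<xi>"
      by (auto simp: \<rho>_def indicator_def intro: ennreal_leI)
  qed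
  finally have "0 < N" .
  with \<open>N < \<infinity>\<close> obtain N' where N': "N = ennreal N'" "0 < N'"
    by (cases N) auto

  \<comment> \<open>\<open>B\<close> is the event that the mixture is at least
    \<open>N / \<delta>\<close>; Markov's inequality gives it probability at most \<delta>.\<close>
  define B where "B = {x \<in> space M. 1 \<le> ennreal (\<delta> / N') * \<Psi> x}"
  have B_meas: "B \<in> sets M" unfolding B_def by measurable
  have "emeasure M B \<le> ennreal (\<delta> / N') * (\<integral>\<^sup>+x. \<Psi> x * indicator (space M) x \<partial>M)"
    unfolding B_def by (rule nn_integral_Markov_inequality) auto
  also have "(\<integral>\<^sup>+x. \<Psi> x * indicator (space M) x \<partial>M) = (\<integral>\<^sup>+x. \<Psi> x \<partial>M)"
    by (rule nn_integral_cong) simp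
  also have "ennreal (\<delta> / N') * \<dots> \<le> ennreal (\<delta> / N') * ennreal N'"
    using \<Psi>_le by (intro mult_left_mono) (auto simp: N')
  also have "\<dots> = ennreal \<delta>"
    using N'(2) \<open>0 < \<delta>\<close> by (simp flip: ennreal_mult)
  finally have B_le: "emeasure M B \<le> ennreal \<delta>" .

  have \<sigma>_nonneg: "AE x in M. 0 \<le> \<sigma> u x" if "u \<in> {1..n}" for u
  proof -
    interpret sigma_finite_subalgebra M "F u" using filt_sub that n by simp
    show ?thesis unfolding \<sigma>_def using meas[OF that] by (intro real_cond_exp_pos) auto
  qed
  then have "AE x in M. \<forall>u\<in>{1..n}. 0 \<le> \<sigma> u x" by (intro AE_finite_allI) auto
  \<comment> \<open>The chosen versions of the conditional variances are nonnegative only almost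
    everywhere. Outside the null set \<open>C\<close>, \<open>H x\<close> is a Gram sum with
    nonnegative coefficients and can be factored.\<close>
  then obtain C where C: "{x \<in> space M. \<not> (\<forall>u\<in>{1..n}. 0 \<le> \<sigma> u x)} \<subseteq> C" "emeasure M C = 0" "C \<in> sets M"
    by (rule AE_E)

  have main: "x \<in> B" if x: "x \<in> space M" and \<sigma>: "\<And>u. u \<in> {1..n} \<Longrightarrow> 0 \<le> \<sigma> u x"
    and large: "mat_norm (matrix_inv (H x)) (S x) \<ge> \<beta>
        + 1 / \<beta> * ln (sqrt (det (H x)) / (\<delta> * l powr (real CARD('d) / 2)))
        + 1 / \<beta> * real CARD('d) * ln 2" for x
  proof -
    obtain P :: "real^'d^'d" where P: "invertible P" "transpose P ** P = H x"
      using regularized_gram_factorization[of "{1..n}" "\<lambda>s. (w s)\<^sup>2 * \<sigma> s x" l "\<lambda>s. a s x"] \<sigma> pos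
      unfolding H_def l_def by auto
    have norm_P: "(norm (P *v \<xi>))\<^sup>2 = (\<Sum>s = 1..n. (w s * (\<xi> \<bullet> a s x))\<^sup>2 * \<sigma> s x) + l * (norm \<xi>)\<^sup>2" for \<xi>
    proof -
      have sum_mv: "(\<Sum>s\<in>I. A s) *v v = (\<Sum>s\<in>I. A s *v v)"
        for A :: "nat \<Rightarrow> real^'d^'d" and I v
        by (induction I rule: infinite_finite_induct) (simp_all add: matrix_vector_mult_add_rdistrib)
      have "(norm (P *v \<xi>))\<^sup>2 = \<xi> \<bullet> (H x *v \<xi>)"
        by (simp add: power2_norm_eq_inner flip: P(2) matrix_vector_mul_assoc)
          (metis dot_lmul_matrix inner_commute)
      also have "\<dots> = (\<Sum>s = 1..n. (w s * (\<xi> \<bullet> a s x))\<^sup>2 * \<sigma> s x) + l * (norm \<xi>)\<^sup>2"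
        by (simp add: H_def l_def matrix_vector_mult_add_rdistrib sum_mv outer_mult_vec inner_add_right
            inner_sum_right power2_norm_eq_inner power_mult_distrib inner_commute
            flip: scaleR_matrix_vector_assoc)
          (simp add: power2_eq_square mult_ac)
      finally show ?thesis .
    qed
    have "l * (norm \<xi>)\<^sup>2 \<le> (norm (P *v \<xi>))\<^sup>2" for \<xi>
      unfolding norm_P using \<sigma> by (auto intro!: sum_nonneg mult_nonneg_nonneg)
    from truncated_mixture_ge[OF P(1) pos(1,3) \<open>0 < \<delta>\<close> this P(2)[symmetric] \<beta>_def large]
    have "N \<le> ennreal \<delta> * (\<integral>\<^sup>+\<xi>. ennreal (exp (\<xi> \<bullet> S x - (norm (P *v \<xi>))\<^sup>2)) * indicator (cball 0 (2 * r)) \<xi> \<partial>lborel)"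
      by (simp only: N_def \<rho>_def)
    \<comment> \<open>The regularization part \<open>l * (norm \<xi>)\<^sup>2\<close> of
      \<open>(norm (P *v \<xi>))\<^sup>2\<close> is the Gaussian weight in \<rho>, and the rest is
      the compensator in \<Phi>; the integral is therefore \<open>\<Psi> x\<close>.\<close>
    also have "(\<lambda>\<xi>. ennreal (exp (\<xi> \<bullet> S x - (norm (P *v \<xi>))\<^sup>2)) * indicator (cball 0 (2 * r)) \<xi>) =
        (\<lambda>\<xi>. \<rho> \<xi> * ennreal (\<Phi> \<xi> x))"
    proof
      fix \<xi>
      have "\<xi> \<bullet> S x - (norm (P *v \<xi>))\<^sup>2 = - l * (norm \<xi>)\<^sup>2 +
          (\<Sum>s = 1..n. (w s * (\<xi> \<bullet> a s x)) * eps (s + 1) x - (w s * (\<xi> \<bullet> a s x))\<^sup>2 * \<sigma> s x)"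
        by (simp add: norm_P S_def inner_sum_right sum_subtractf mult_ac)
      then show "ennreal (exp (\<xi> \<bullet> S x - (norm (P *v \<xi>))\<^sup>2)) * indicator (cball 0 (2 * r)) \<xi> =
          \<rho> \<xi> * ennreal (\<Phi> \<xi> x)"
        by (simp only: exp_add ennreal_mult' exp_ge_zero \<rho>_def \<Phi>_def mult_ac)
    qed
    finally have "ennreal (1 / N') * N \<le> ennreal (1 / N') * (ennreal \<delta> * \<Psi> x)"
      unfolding \<Psi>_def by (intro mult_left_mono) auto
    also have "\<dots> = ennreal (\<delta> / N') * \<Psi> x"
      using N'(2) \<open>0 < \<delta>\<close> by (simp add: mult.assoc[symmetric] flip: ennreal_mult)
    also have "ennreal (1 / N') * N = 1"
      using N' by (simp flip: ennreal_mult)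
    finally show ?thesis using x by (simp add: B_def)
  qed
  \<comment> \<open>The measurable witness \<open>A\<close> is \<open>B \<union> C\<close>, and
    adding the null set \<open>C\<close> keeps its probability at most \<delta>.\<close>
  have "emeasure M (B \<union> C) \<le> ennreal \<delta>"
    using B_le C B_meas emeasure_subadditive[of B M C] by simp
  then have "prob (B \<union> C) \<le> \<delta>"
    using \<open>0 < \<delta>\<close> by (simp add: emeasure_eq_measure)
  moreover have "{x \<in> space M. mat_norm (matrix_inv (H x)) (S x) \<ge> \<beta>
        + 1 / \<beta> * ln (sqrt (det (H x)) / (\<delta> * l powr (real CARD('d) / 2)))
        + 1 / \<beta> * real CARD('d) * ln 2} \<subseteq> B \<union> C"
    using main C(1) by blast
  moreover have "B \<union> C \<in> sets M" using B_meas C by simp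
  moreover have "\<beta> = sqrt (lam (t - 1)) / (2 * m * w (t - 1))"
      "1 / \<beta> = 2 * m * w (t - 1) / sqrt (lam (t - 1))"
    by (simp_all add: \<beta>_def r_def l_def n_def)
  ultimately show ?thesis
    unfolding Let_def H_def S_def \<sigma>_def l_def n_def by auto
qed

end
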